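(* Let $C$ be a bivariate copula, let $\alpha\in[0,1]$, and let $$C_\alpha(u,v)=C(u,v)+\frac{\alpha}{2}\big[M(u,v)-W(u,v)\big],\qquad (u,v)\in[0,1]^2,$$ where $M(u,v)=\min(u,v)$ and $W(u,v)=\max(u+v-1,0)$. Then Spearman's rho, Blomqvist's beta, Gini's gamma and Kendall's tau of $C_\alpha$ are given by $$\rho(C_\alpha)=\rho(C)+\alpha,\qquad \beta(C_\alpha)=\beta(C)+\alpha,\qquad \gamma(C_\alpha)=\gamma(C)+\alpha,$$ $$\tau(C_\alpha)=\tau(C)+2\alpha\int_0^1\int_0^1\big[M(u,v)-W(u,v)\big]\frac{\partial^2 C}{\partial u\,\partial v}\,du\,dv.$$
   Context: A bivariate copula is a function $C:[0,1]^2\to[0,1]$ with $C(u,0)=C(0,v)=0$, $C(u,1)=u$, $C(1,v)=v$ for all $u,v\in[0,1]$, and which is 2-increasing: $C(u_1,v_1)+C(u_2,v_2)-C(u_1,v_2)-C(u_2,v_1)\ge 0$ whenever $0\le u_1\le u_2\le1$, $0\le v_1\le v_2\le 1$. For a function $D$ on $[0,1]^2$ (here $D=C$ or $D=C_\alpha$), the measures of dependency are given by the formulas: Spearman's rho $\rho(D)=12\int_0^1\int_0^1 D(u,v)\,du\,dv-3$; Blomqvist's beta $\beta(D)=4D\left(\tfrac12,\tfrac12\right)-1$; Gini's gamma $\gamma(D)=4\int_0^1\left[D(u,u)+D(u,1-u)-u\right]du$; Kendall's tau $\tau(D)=4\int_0^1\int_0^1 D(u,v)\frac{\partial^2 D}{\partial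 u\,\partial v}\,du\,dv-1$, where the mixed partial derivative is taken pointwise almost everywhere. *)

theory Defs
  imports "HOL-Analysis.Analysis"
begin

text \<open>Functions on the unit square are curried functions on all pairs of reals; nothing below
  depends on their values outside the unit square. All integrals are gauge integrals, so they
  are insensitive to changes of the integrand on null sets.\<close>

definition is_copula :: "(real \<Rightarrow> real \<Rightarrow> real) \<Rightarrow> bool" where
  "is_copula C \<longleftrightarrow>
     (\<forall>u\<in>{0..1}. \<forall>v\<in>{0..1}. C u v \<in> {0..1}) \<and>
     (\<forall>u\<in>{0..1}. C u 0 = 0 \<and> C u 1 = u) \<and>
     (\<forall>v\<in>{0..1}. C 0 v = 0 \<and> C 1 v = v) \<and>
     (\<forall>u1 u2 v1 v2. 0 \<le> u1 \<and> u1 \<le> u2 \<and> u2 \<le> 1 \<and> 0 \<le> v1 \<and> v1 \<le> v2 \<and> v2 \<le> 1 \<longrightarrow>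
        C u1 v1 + C u2 v2 - C u1 v2 - C u2 v1 \<ge> 0)"

definition M_cop :: "real \<Rightarrow> real \<Rightarrow> real" where
  "M_cop u v = min u v"

definition W_cop :: "real \<Rightarrow> real \<Rightarrow> real" where
  "W_cop u v = max (u + v - 1) 0"

definition C_alpha :: "(real \<Rightarrow> real \<Rightarrow> real) \<Rightarrow> real \<Rightarrow> real \<Rightarrow> real \<Rightarrow> real" where
  "C_alpha C \<alpha> u v = C u v + \<alpha> / 2 * (M_cop u v - W_cop u v)"

definition partial_v :: "(real \<Rightarrow> real \<Rightarrow> real) \<Rightarrow> real \<Rightarrow> real \<Rightarrow> real" where
  "partial_v D u v = vector_derivative (\<lambda>w. D u w) (at v within {0..1})"

definition partial_v_dom :: "(real \<Rightarrow> real \<Rightarrow> real) \<Rightarrow> real \<Rightarrow> real set" where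
  "partial_v_dom D v = {u \<in> {0..1}. (\<lambda>w. D u w) differentiable (at v within {0..1})}"

text \<open>The mixed partial derivative is the \<open>u\<close>-derivative of the \<open>v\<close>-derivative. For a copula
  the \<open>v\<close>-derivative is only defined almost everywhere; for a copula with singular components,
  the exceptional \<open>u\<close> can be dense in the unit interval for every \<open>v\<close>. The outer derivative is
  therefore taken within the set where the inner one exists: otherwise the arbitrary values of
  \<open>vector_derivative\<close> at non-differentiable points would enter the difference quotients. Where
  this derivative does not exist the value is unspecified.\<close>

definition mixed_partial :: "(real \<Rightarrow> real \<Rightarrow> real) \<Rightarrow> real \<Rightarrow> real \<Rightarrow> real" where
  "mixed_partial D u v =
     vector_derivative (\<lambda>s. partial_v D s v) (at u within partial_v_dom D v)"

definition spearman_rho :: "(real \<Rightarrow> real \<Rightarrow> real) \<Rightarrow> real" where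
  "spearman_rho D = 12 * integral {0..1} (\<lambda>v. integral {0..1} (\<lambda>u. D u v)) - 3"

definition blomqvist_beta :: "(real \<Rightarrow> real \<Rightarrow> real) \<Rightarrow> real" where
  "blomqvist_beta D = 4 * D (1/2) (1/2) - 1"

definition gini_gamma :: "(real \<Rightarrow> real \<Rightarrow> real) \<Rightarrow> real" where
  "gini_gamma D = 4 * integral {0..1} (\<lambda>u. D u u + D u (1 - u) - u)"

definition kendall_tau :: "(real \<Rightarrow> real \<Rightarrow> real) \<Rightarrow> real" where
  "kendall_tau D =
     4 * integral {0..1} (\<lambda>v. integral {0..1} (\<lambda>u. D u v * mixed_partial D u v)) - 1"

end

theory Submission
  imports Defs
begin

text \<open>For Spearman's rho, Blomqvist's beta and Gini's gamma the shift is a direct integration of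
  \<open>M - W\<close>. For Kendall's tau, the mixed derivatives of \<open>C_alpha\<close> and \<open>C\<close> agree almost everywhere,
  because the \<open>v\<close>-derivative of \<open>M - W\<close> is locally constant in \<open>u\<close> off the two diagonals; the work
  lies in splitting the integral, which needs integrability of the mixed derivative. Since
  \<open>C u\<close> is monotone and 1-Lipschitz, it is differentiable almost everywhere, so by Fubini the
  domain of the \<open>v\<close>-derivative has full measure for almost every \<open>v\<close>. There the \<open>v\<close>-derivative
  coincides with an upper derivative that is monotone in \<open>u\<close>, Borel measurable and bounded
  by 1. Differentiating a monotone function within a dense set is the same as differentiating
  it, so the mixed derivative is the derivative of that upper derivative, and Fatou's lemma
  bounds its integral by 1. Existence of the mixed derivative almost everywhere is not needed:
  where it does not exist, \<open>vector_derivative\<close> is a fixed constant.\<close>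

subsection \<open>Derivatives of monotone functions\<close>

lemma dense_both_sides:
  fixes S :: "real set"
  assumes "closure S = UNIV" "open U" "y \<in> U"
  obtains a b where "a \<in> S" "b \<in> S" "a \<in> U" "b \<in> U" "a < y" "y < b"
proof -
  obtain e where e: "e > 0" "ball y e \<subseteq> U"
    using assms(2,3) by (auto simp: open_contains_ball)
  have *: "\<exists>s\<in>S. s \<in> {l<..<r}" if "l < r" for l r
    using assms(1) that open_Int_closure_eq_empty[of "{l<..<r}" S] by (auto simp: disjoint_iff)
  obtain a where "a \<in> S" "a \<in> {y - e<..<y}" using *[of "y-e" y] e(1) by auto
  moreover obtain b where "b \<in> S" "b \<in> {y<..<y+e}" using *[of y "y+e"] e(1) by auto
  ultimately show ?thesis
    using e by (intro that[of a b]) (auto simp: dist_real_def subset_iff)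
qed

text \<open>If \<open>f y\<close> were too large for the estimate, the bound would stay strictly
  below \<open>f y\<close> on an open set around \<open>y\<close>. That set contains a point of
  \<open>S\<close> to the right of \<open>y\<close>, where monotonicity makes \<open>f\<close> at
  least \<open>f y\<close>, against the estimate on \<open>S\<close>. Too small a value is refuted
  from the left.\<close>

lemma mono_derivative_from_dense:
  fixes f :: "real \<Rightarrow> real"
  assumes "mono f" "closure S = UNIV"
    and der: "(f has_vector_derivative d) (at x within S)"
  shows "(f has_vector_derivative d) (at x)"
  unfolding has_vector_derivative_def has_derivative_within_alt
proof (intro conjI allI impI)
  show "bounded_linear (\<lambda>h. h *\<^sub>R d)" by (rule bounded_linear_scaleR_left)
  fix e :: real assume "e > 0"
  then obtain r where r: "r > 0" "\<And>y. y \<in> S \<Longrightarrow> \<bar>y - x\<bar> < r \<Longrightarrow> \<bar>f y - f x - (y - x) * d\<bar> \<le> e * \<bar>y - x\<bar>"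
    using der unfolding has_vector_derivative_def has_derivative_within_alt by auto
  show "\<exists>r>0. \<forall>y\<in>UNIV. norm (y - x) < r \<longrightarrow> norm (f y - f x - (y - x) *\<^sub>R d) \<le> e * norm (y - x)"
  proof (intro exI[of _ r] conjI ballI impI)
    fix y assume "norm (y - x) < r"
    have "f y \<le> f x + (y - x) * d + e * \<bar>y - x\<bar>"
    proof (rule ccontr)
      assume c: "\<not> ?thesis"
      let ?U = "{s. \<bar>s - x\<bar> < r} \<inter> {s. f x + (s - x) * d + e * \<bar>s - x\<bar> < f y}"
      have "open ?U" by (intro open_Int open_Collect_less continuous_intros)
      then obtain b where "b \<in> S" "b \<in> ?U" "y < b"
        using dense_both_sides[OF assms(2), of ?U y] c \<open>norm (y - x) < r\<close> by auto
      then show False using r(2)[of b] monoD[OF assms(1), of y b] by auto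
    qed
    moreover have "f y \<ge> f x + (y - x) * d - e * \<bar>y - x\<bar>"
    proof (rule ccontr)
      assume c: "\<not> ?thesis"
      let ?U = "{s. \<bar>s - x\<bar> < r} \<inter> {s. f x + (s - x) * d - e * \<bar>s - x\<bar> > f y}"
      have "open ?U" by (intro open_Int open_Collect_less continuous_intros)
      then obtain b where "b \<in> S" "b \<in> ?U" "b < y"
        using dense_both_sides[OF assms(2), of ?U y] c \<open>norm (y - x) < r\<close> by auto
      then show False using r(2)[of b] monoD[OF assms(1), of b y] by auto
    qed
    ultimately show "norm (f y - f x - (y - x) *\<^sub>R d) \<le> e * norm (y - x)"
      by (auto simp: abs_le_iff)
  qed (use r in auto)
qed

section \<open>Almost everywhere differentiability of monotone Lipschitz functions\<close>

lemma continuous_on_mono_Lipschitz: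
  fixes f :: "real \<Rightarrow> real"
  assumes mono: "\<And>x y. x \<le> y \<Longrightarrow> f x \<le> f y"
    and lip: "\<And>x y. x \<le> y \<Longrightarrow> f y - f x \<le> y - x"
  shows "continuous_on UNIV f"
  by (rule lipschitz_on_continuous_on[of 1], rule lipschitz_onI)
     (use mono lip in \<open>auto simp: dist_real_def abs_if, (smt (verit))+\<close>)

text \<open>Both \<open>f\<close> and \<open>\<lambda>x. x - f x\<close> are monotone, and their interval measures add up to Lebesgue
  measure.\<close>

lemma interval_measure_le_lborel:
  fixes f :: "real \<Rightarrow> real"
  assumes mono: "\<And>x y. x \<le> y \<Longrightarrow> f x \<le> f y"
    and lip: "\<And>x y. x \<le> y \<Longrightarrow> f y - f x \<le> y - x"
  assumes A: "A \<in> sets borel"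
  shows "emeasure (interval_measure f) A \<le> emeasure lborel A"
proof -
  have cont: "continuous_on UNIV f"
    using mono lip by (rule continuous_on_mono_Lipschitz)
  define g where "g = (\<lambda>x. x - f x)"
  have gm: "g x \<le> g y" if "x \<le> y" for x y using lip[OF that] by (simp add: g_def)
  have gc: "continuous_on UNIV g" unfolding g_def by (intro continuous_intros cont)
  let ?m = "interval_measure f" and ?n = "interval_measure g"
  define P where "P = measure_of UNIV (sets borel) (\<lambda>A. emeasure ?m A + emeasure ?n A)"
  have sP: "sets P = sets borel"
    unfolding P_def using sets.sets_measure_of_eq[of "borel::real measure"] by simp
  have eP: "emeasure P A = emeasure ?m A + emeasure ?n A" if "A \<in> sets borel" for A
  proof (rule emeasure_measure_of[OF P_def])
    show "sets borel \<subseteq> Pow (UNIV::real set)" by simp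
    show "positive (sets P) (\<lambda>A. emeasure ?m A + emeasure ?n A)" by (simp add: positive_def)
    show "countably_additive (sets P) (\<lambda>A. emeasure ?m A + emeasure ?n A)"
      unfolding countably_additive_def sP
    proof (intro allI impI)
      fix B :: "nat \<Rightarrow> real set"
      assume B: "range B \<subseteq> sets borel" "disjoint_family B"
      have "(\<Sum>i. emeasure ?m (B i) + emeasure ?n (B i)) = (\<Sum>i. emeasure ?m (B i)) + (\<Sum>i. emeasure ?n (B i))"
        by (intro suminf_add[symmetric]) auto
      also have "\<dots> = emeasure ?m (\<Union>(range B)) + emeasure ?n (\<Union>(range B))"
        using B by (simp add: suminf_emeasure)
      finally show "(\<Sum>i. emeasure ?m (B i) + emeasure ?n (B i)) = emeasure ?m (\<Union>(range B)) + emeasure ?n (\<Union>(range B))" .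
    qed
  qed (use that sP in auto)
  \<comment> \<open>Lebesgue measure is determined by its values on boxes, and there the two masses
    add up to \<open>(f u - f l) + (g u - g l) = u - l\<close>.\<close>
  have "lborel = P"
  proof (rule lborel_eqI)
    show "emeasure P (box l u) = ennreal (\<Prod>b\<in>Basis. (u - l) \<bullet> b)" if "\<And>b. b \<in> Basis \<Longrightarrow> l \<bullet> b \<le> u \<bullet> b" for l u :: real
    proof -
      have lu: "l \<le> u" using that[of 1] by simp
      have *: "emeasure (interval_measure h) {l<..<u} = ennreal (h u - h l)"
        if h: "\<And>x y. x \<le> y \<Longrightarrow> h x \<le> h y" "continuous_on UNIV h" for h :: "real \<Rightarrow> real"
      proof -
        have r: "continuous (at_right a) h" for a
          using h(2) by (meson UNIV_I continuous_on_eq_continuous_at continuous_at_imp_continuous_at_within open_UNIV)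
        \<comment> \<open>Boxes are open, while the interval measure is known on half-open
          intervals; by continuity the endpoint carries no mass.\<close>
        have s: "emeasure (interval_measure h) {u} = 0"
          using emeasure_interval_measure_Icc[of u u h] h by simp
        show ?thesis
        proof (cases "l < u")
          case True
          then have "{l<..u} = {l<..<u} \<union> {u}" by auto
          then have "emeasure (interval_measure h) {l<..u} = emeasure (interval_measure h) {l<..<u} + emeasure (interval_measure h) {u}"
            by (simp add: plus_emeasure)
          then show ?thesis using s emeasure_interval_measure_Ioc[OF lu h(1) r] by simp
        qed (use lu in auto)
      qed
      show ?thesis
        using *[OF mono cont] *[OF gm gc] mono[OF lu] gm[OF lu]
        by (simp add: eP ennreal_plus[symmetric] g_def del: ennreal_plus)
    qed
  qed (rule sP)
  then show ?thesis using eP[OF A] by simp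
qed

text \<open>Domination by Lebesgue measure makes the interval measure of \<open>f\<close> absolutely
  continuous, so Radon-Nikodym supplies a density, and integrating it over \<open>{a..b}\<close>
  returns the mass \<open>f b - f a\<close>.\<close>

lemma mono_Lipschitz_integral:
  fixes f :: "real \<Rightarrow> real"
  assumes mono: "\<And>x y. x \<le> y \<Longrightarrow> f x \<le> f y"
    and lip: "\<And>x y. x \<le> y \<Longrightarrow> f y - f x \<le> y - x"
  obtains h where "\<And>a b. a \<le> b \<Longrightarrow> (h has_integral (f b - f a)) {a..b}"
proof -
  have cont: "continuous_on UNIV f"
    using mono lip by (rule continuous_on_mono_Lipschitz)
  have r: "continuous (at_right a) f" for a
    using cont by (meson UNIV_I continuous_on_eq_continuous_at continuous_at_imp_continuous_at_within open_UNIV)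
  let ?m = "interval_measure f"
  have "absolutely_continuous lborel ?m"
    unfolding absolutely_continuous_def
  proof
    fix A :: "real set" assume "A \<in> null_sets lborel"
    then have "A \<in> sets borel" "emeasure lborel A = 0" by (auto simp: null_sets_def)
    then show "A \<in> null_sets ?m"
      using interval_measure_le_lborel[of f A, OF mono lip] by (auto simp: null_sets_def)
  qed
  then obtain h where hm[measurable]: "h \<in> borel_measurable borel" and h: "density lborel h = ?m"
    using sigma_finite_measure.Radon_Nikodym[OF sigma_finite_lborel, of ?m] by auto
  have I: "(\<integral>\<^sup>+x. h x * indicator {a..b} x \<partial>lborel) = ennreal (f b - f a)" if "a \<le> b" for a b
    using emeasure_interval_measure_Icc[OF that mono cont] unfolding h[symmetric]
    by (simp add: emeasure_density)
  \<comment> \<open>Each \<open>{-n..n}\<close> has finite mass, so the density is infinite only on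
    a null set and \<open>enn2real\<close> may replace it under the integral.\<close>
  have fin: "AE x in lborel. h x \<noteq> \<infinity>"
  proof -
    have "AE x in lborel. h x * indicator {-real n..real n} x \<noteq> \<infinity>" for n
      by (rule nn_integral_noteq_infinite) (auto simp: I)
    then have "AE x in lborel. \<forall>n. h x * indicator {-real n..real n} x \<noteq> \<infinity>"
      by (simp add: AE_all_countable)
    then show ?thesis
    proof (rule AE_mp, intro AE_I2 impI)
      fix x :: real assume a: "\<forall>n. h x * indicator {-real n..real n} x \<noteq> \<infinity>"
      obtain n where "\<bar>x\<bar> \<le> real n" using real_arch_simple by blast
      then have "x \<in> {-real n..real n}" by auto
      then show "h x \<noteq> \<infinity>" using a[rule_format, of n] by simp
    qed
  qed
  show ?thesis
  proof
    fix a b :: real assume ab: "a \<le> b"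
    have "(\<integral>\<^sup>+x. ennreal (enn2real (h x) * indicator {a..b} x) \<partial>lborel) = (\<integral>\<^sup>+x. h x * indicator {a..b} x \<partial>lborel)"
      by (rule nn_integral_cong_AE, rule AE_mp[OF fin], intro AE_I2)
         (auto simp: indicator_def less_top)
    then have "(\<integral>\<^sup>+x. ennreal (enn2real (h x) * indicator {a..b} x) \<partial>lborel) = ennreal (f b - f a)"
      using I[OF ab] by simp
    then have "((\<lambda>x. enn2real (h x) * indicator {a..b} x) has_integral (f b - f a)) UNIV"
      using mono[OF ab] by (intro nn_integral_has_integral) (auto simp: )
    then show "((\<lambda>x. enn2real (h x)) has_integral (f b - f a)) {a..b}"
      by (subst has_integral_restrict_UNIV[symmetric], rule has_integral_eq_rhs[OF has_integral_eq[rotated]])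
         (auto simp: indicator_def)
  qed
qed

text \<open>This is Lebesgue differentiation of the density \<open>h\<close>. The averages in
  \<open>integrable_ccontinuous_explicit\<close> run over intervals that start at \<open>x\<close>,
  which controls right difference quotients; the reflected density controls the left ones.\<close>

lemma mono_Lipschitz_AE_differentiable:
  fixes f :: "real \<Rightarrow> real"
  assumes mono: "\<And>x y. x \<le> y \<Longrightarrow> f x \<le> f y"
    and lip: "\<And>x y. x \<le> y \<Longrightarrow> f y - f x \<le> y - x"
  shows "AE x in lebesgue. f differentiable (at x)"
proof -
  obtain h where h: "\<And>a b. a \<le> b \<Longrightarrow> (h has_integral (f b - f a)) {a..b}"
    using mono_Lipschitz_integral[of f] mono lip by metis
  have h': "((\<lambda>x. h (- x)) has_integral (f (-a) - f (-b))) {a..b}" if "a \<le> b" for a b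
    using h[of "-b" "-a"] that by (subst has_integral_reflect_real[symmetric]) simp
  have "h integrable_on cbox a b" for a b
    using h[of a b] by (cases "a \<le> b") (auto simp: integrable_on_def)
  then obtain N where N: "negligible N" "\<And>x e. x \<notin> N \<Longrightarrow> 0 < e \<Longrightarrow>
      \<exists>d>0. \<forall>t. 0 < t \<and> t < d \<longrightarrow> norm (integral (cbox x (x + t *\<^sub>R One)) h /\<^sub>R t ^ DIM(real) - h x) < e"
    using integrable_ccontinuous_explicit[of h] by metis
  have "(\<lambda>x. h (- x)) integrable_on cbox a b" for a b
    using h'[of a b] by (cases "a \<le> b") (auto simp: integrable_on_def)
  then obtain N' where N': "negligible N'" "\<And>x e. x \<notin> N' \<Longrightarrow> 0 < e \<Longrightarrow>
      \<exists>d>0. \<forall>t. 0 < t \<and> t < d \<longrightarrow> norm (integral (cbox x (x + t *\<^sub>R One)) (\<lambda>x. h (- x)) /\<^sub>R t ^ DIM(real) - h (- x)) < e"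
    using integrable_ccontinuous_explicit[of "\<lambda>x. h (- x)"] by metis
  \<comment> \<open>Negation is differentiable, so it carries the exceptional set of the reflected
    density to a null set.\<close>
  have neg: "negligible (N \<union> uminus ` N')"
    using N(1) N'(1) by (intro negligible_Un negligible_differentiable_image_negligible) (auto intro!: derivative_intros simp: differentiable_on_def)
  have "f differentiable (at x)" if x: "x \<notin> N \<union> uminus ` N'" for x
  proof -
    have "(f has_vector_derivative h x) (at x)"
      unfolding has_vector_derivative_def has_derivative_within_alt
    proof (intro conjI allI impI)
      show "bounded_linear (\<lambda>t. t *\<^sub>R h x)" by (rule bounded_linear_scaleR_left)
      fix e :: real assume e: "e > 0"
      obtain d1 where d1: "d1 > 0" "\<And>t. 0 < t \<Longrightarrow> t < d1 \<Longrightarrow> \<bar>(f (x + t) - f x) / t - h x\<bar> < e"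
      proof -
        have "integral (cbox x (x + t *\<^sub>R One)) h = f (x + t) - f x" if "t > 0" for t
          using h[of x "x+t"] that by (simp add: integral_unique)
        then show ?thesis using N(2)[of x e] x e that by (auto simp: divide_inverse mult.commute)
      qed
      obtain d2 where d2: "d2 > 0" "\<And>t. 0 < t \<Longrightarrow> t < d2 \<Longrightarrow> \<bar>(f x - f (x - t)) / t - h x\<bar> < e"
      proof -
        have "integral (cbox (-x) (-x + t *\<^sub>R One)) (\<lambda>x. h (- x)) = f x - f (x - t)" if "t > 0" for t
          using h'[of "-x" "-x+t"] that by (simp add: integral_unique)
        moreover have "- x \<notin> N'" using x by force
        ultimately show ?thesis using N'(2)[of "-x" e] e that by (auto simp: divide_inverse mult.commute)
      qed
      show "\<exists>r>0. \<forall>y\<in>UNIV. norm (y - x) < r \<longrightarrow> norm (f y - f x - (y - x) *\<^sub>R h x) \<le> e * norm (y - x)"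
      proof (intro exI[of _ "min d1 d2"] conjI ballI impI)
        fix y assume y: "norm (y - x) < min d1 d2"
        consider "y = x" | "y > x" | "y < x" by linarith
        then show "norm (f y - f x - (y - x) *\<^sub>R h x) \<le> e * norm (y - x)"
        proof cases
          case 2
          have "f y - f x - (y - x) * h x = ((f (x + (y-x)) - f x) / (y-x) - h x) * (y - x)"
            using 2 by (simp add: divide_simps algebra_simps)
          then have "\<bar>f y - f x - (y - x) * h x\<bar> = \<bar>(f (x + (y-x)) - f x) / (y-x) - h x\<bar> * \<bar>y - x\<bar>"
            by (simp only: abs_mult)
          also have "\<dots> \<le> e * \<bar>y - x\<bar>"
            using d1(2)[of "y-x"] y 2 by (intro mult_right_mono) auto
          finally show ?thesis by simp
        next
          case 3
          have "f y - f x - (y - x) * h x = ((f x - f (x - (x-y))) / (x-y) - h x) * (y - x)"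
            using 3 by (simp add: divide_simps algebra_simps)
          then have "\<bar>f y - f x - (y - x) * h x\<bar> = \<bar>(f x - f (x - (x-y))) / (x-y) - h x\<bar> * \<bar>y - x\<bar>"
            by (simp only: abs_mult)
          also have "\<dots> \<le> e * \<bar>y - x\<bar>"
            using d2(2)[of "x-y"] y 3 by (intro mult_right_mono) auto
          finally show ?thesis by simp
        qed simp
      qed (use d1 d2 in auto)
    qed
    then show ?thesis by (rule differentiableI_vector)
  qed
  then have "{x. \<not> f differentiable (at x)} \<subseteq> N \<union> uminus ` N'" by auto
  then show ?thesis
    using neg negligible_subset
    by (auto simp: eventually_ae_filter negligible_iff_null_sets)
qed

section \<open>Measurability of derivatives of monotone functions\<close>

lemma has_vector_derivative_LIMSEQ:
  fixes f :: "real \<Rightarrow> real"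
  assumes "(f has_vector_derivative d) (at x)"
  shows "(\<lambda>n. (f (x + 1 / real (Suc n)) - f x) * real (Suc n)) \<longlonglongrightarrow> d"
proof -
  have "((\<lambda>h. (f (x + h) - f x) / h) \<longlongrightarrow> d) (at 0)"
    using assms by (simp add: has_real_derivative_iff_has_vector_derivative[symmetric] DERIV_def)
  moreover have "filterlim (\<lambda>n. 1 / real (Suc n)) (at 0) sequentially"
    using LIMSEQ_inverse_real_of_nat unfolding filterlim_at by (auto simp: divide_inverse)
  ultimately have "(\<lambda>n. (f (x + 1 / real (Suc n)) - f x) / (1 / real (Suc n))) \<longlonglongrightarrow> d"
    by (rule filterlim_compose)
  then show ?thesis by simp
qed

text \<open>The estimate at rational points gives the derivative within a dense set, hence the full
  derivative by \<open>mono_derivative_from_dense\<close>. Tolerances \<open>1 / Suc k\<close> and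
  radii \<open>1 / Suc n\<close> make the remaining quantifiers countable too.\<close>

lemma mono_has_vector_derivative_iff_rational:
  fixes f :: "real \<Rightarrow> real"
  assumes "mono f"
  shows "(f has_vector_derivative d) (at x) \<longleftrightarrow>
    (\<forall>k::nat. \<exists>n::nat. \<forall>y\<in>\<rat>. \<bar>y - x\<bar> < 1 / real (Suc n) \<longrightarrow>
       \<bar>f y - f x - (y - x) * d\<bar> \<le> \<bar>y - x\<bar> / real (Suc k))" (is "_ \<longleftrightarrow> ?R")
proof
  assume "(f has_vector_derivative d) (at x)"
  then have D: "\<And>e. e > 0 \<Longrightarrow> \<exists>r>0. \<forall>y. \<bar>y - x\<bar> < r \<longrightarrow> \<bar>f y - f x - (y - x) * d\<bar> \<le> e * \<bar>y - x\<bar>"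
    unfolding has_vector_derivative_def has_derivative_within_alt by auto
  show ?R
  proof
    fix k :: nat
    obtain r where r: "r > 0" "\<And>y. \<bar>y - x\<bar> < r \<Longrightarrow> \<bar>f y - f x - (y - x) * d\<bar> \<le> 1 / real (Suc k) * \<bar>y - x\<bar>"
      using D[of "1 / real (Suc k)"] by auto
    obtain n where "1 / real (Suc n) < r" using nat_approx_posE[OF r(1)] by metis
    then show "\<exists>n::nat. \<forall>y\<in>\<rat>. \<bar>y - x\<bar> < 1 / real (Suc n) \<longrightarrow>
       \<bar>f y - f x - (y - x) * d\<bar> \<le> \<bar>y - x\<bar> / real (Suc k)"
      using r(2) by (intro exI[of _ n]) (auto intro: order_trans)
  qed
next
  assume R: ?R
  have "(f has_vector_derivative d) (at x within \<rat>)"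
    unfolding has_vector_derivative_def has_derivative_within_alt
  proof (intro conjI allI impI)
    show "bounded_linear (\<lambda>h. h *\<^sub>R d)" by (rule bounded_linear_scaleR_left)
    fix e :: real assume "e > 0"
    then obtain k where k: "1 / real (Suc k) < e" using nat_approx_posE by metis
    obtain n :: nat where n: "\<And>y. y \<in> \<rat> \<Longrightarrow> \<bar>y - x\<bar> < 1 / real (Suc n) \<Longrightarrow>
       \<bar>f y - f x - (y - x) * d\<bar> \<le> \<bar>y - x\<bar> / real (Suc k)" using R by blast
    have "\<bar>y - x\<bar> / real (Suc k) \<le> e * \<bar>y - x\<bar>" for y
      using mult_right_mono[OF less_imp_le[OF k], of "\<bar>y - x\<bar>"] by simp
    then show "\<exists>r>0. \<forall>y\<in>\<rat>. norm (y - x) < r \<longrightarrow> norm (f y - f x - (y - x) *\<^sub>R d) \<le> e * norm (y - x)"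
      using n by (intro exI[of _ "1 / real (Suc n)"]) (auto intro: order_trans)
  qed
  then show "(f has_vector_derivative d) (at x)"
    using assms by (intro mono_derivative_from_dense[where S = \<rat>]) (auto simp: Rats_closure_real)
qed

text \<open>Monotonicity lets the difference quotients be tested at rational points only, which turns
  differentiability into a countable condition.\<close>

lemma
  fixes f :: "'a \<Rightarrow> real \<Rightarrow> real"
  assumes mono: "\<And>a. mono (f a)"
    and meas[measurable]: "(\<lambda>(a, x). f a x) \<in> borel_measurable (M \<Otimes>\<^sub>M borel)"
  shows pred_differentiable_mono: "Measurable.pred (M \<Otimes>\<^sub>M borel) (\<lambda>(a, x). f a differentiable (at x))"
    and borel_measurable_vector_derivative_mono:
      "(\<lambda>(a, x). vector_derivative (f a) (at x)) \<in> borel_measurable (M \<Otimes>\<^sub>M borel)"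
proof -
  \<comment> \<open>Any derivative must equal \<open>L\<close>, a limit of measurable quotients.
    Inserting \<open>L\<close> removes the uncountable quantifier over the value of the
    derivative.\<close>
  define L where "L = (\<lambda>a x. lim (\<lambda>n. (f a (x + 1 / real (Suc n)) - f a x) * real (Suc n)))"
  have L: "d = L a x" if "(f a has_vector_derivative d) (at x)" for a x d
    using has_vector_derivative_LIMSEQ[OF that] by (simp add: L_def limI)
  have [measurable]: "(\<lambda>p. f (fst p) (g p)) \<in> borel_measurable (M \<Otimes>\<^sub>M borel)"
    if [measurable]: "g \<in> borel_measurable (M \<Otimes>\<^sub>M borel)" for g :: "'a \<times> real \<Rightarrow> real"
    using measurable_compose[OF _ meas, of "\<lambda>p. (fst p, g p)"] by simp
  have Lm[measurable]: "(\<lambda>p. L (fst p) (snd p)) \<in> borel_measurable (M \<Otimes>\<^sub>M borel)"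
    unfolding L_def by measurable
  have iff: "f a differentiable (at x) \<longleftrightarrow> (\<forall>k::nat. \<exists>n::nat. \<forall>y\<in>\<rat>. \<bar>y - x\<bar> < 1 / real (Suc n) \<longrightarrow>
       \<bar>f a y - f a x - (y - x) * L a x\<bar> \<le> \<bar>y - x\<bar> / real (Suc k))" for a x
    unfolding mono_has_vector_derivative_iff_rational[OF mono, symmetric]
    using L by (metis differentiableI_vector vector_derivative_works)
  show pred: "Measurable.pred (M \<Otimes>\<^sub>M borel) (\<lambda>(a, x). f a differentiable (at x))"
    unfolding iff split_beta Rats_def ball_simps by measurable
  then have [measurable]: "Measurable.pred (M \<Otimes>\<^sub>M borel) (\<lambda>p. f (fst p) differentiable (at (snd p)))"
    by (simp add: split_beta)
  \<comment> \<open>Without a derivative, \<open>vector_derivative\<close> chooses from an empty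
    predicate; the chosen value is the same constant at all such points, so measurability
    survives.\<close>
  have "vector_derivative (f a) (at x) = (if f a differentiable (at x) then L a x else (SOME d. False))" for a x
  proof (cases "f a differentiable (at x)")
    case False
    then have "\<not> (f a has_vector_derivative d) (at x)" for d using differentiableI_vector by blast
    with False show ?thesis by (simp add: vector_derivative_def)
  next
    case True
    then show ?thesis using L vector_derivative_works by metis
  qed
  then have "(\<lambda>(a, x). vector_derivative (f a) (at x)) =
      (\<lambda>p. if f (fst p) differentiable (at (snd p)) then L (fst p) (snd p) else (SOME d. False))"
    by (auto simp: fun_eq_iff)
  then show "(\<lambda>(a, x). vector_derivative (f a) (at x)) \<in> borel_measurable (M \<Otimes>\<^sub>M borel)"
    by simp
qed

section \<open>Integrals of derivatives, and iterated gauge integrals\<close>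

lemma AE_lborel_iff_negligible:
  "(AE x in lborel. P x) \<longleftrightarrow> negligible {x::'a::euclidean_space. \<not> P x}"
proof -
  have "(AE x in lborel. P x) \<longleftrightarrow> (AE x in lebesgue. P x)" by (simp add: AE_completion_iff)
  also have "\<dots> \<longleftrightarrow> {x. \<not> P x} \<in> null_sets lebesgue"
    using AE_iff_null_sets[of "{x. \<not> P x}" lebesgue] null_sets_completion_subset
    by (auto simp: eventually_ae_filter)
  finally show ?thesis by (simp add: negligible_iff_null_sets)
qed

lemma has_integral_indicator_UNIV:
  fixes f :: "'a::euclidean_space \<Rightarrow> real"
  shows "((\<lambda>x. indicator S x * f x) has_integral I) UNIV \<longleftrightarrow> (f has_integral I) S"
proof -
  have "(\<lambda>x. indicator S x * f x) = (\<lambda>x. if x \<in> S then f x else 0)" by (auto simp: indicator_def)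
  then show ?thesis by (simp add: has_integral_restrict_UNIV)
qed

text \<open>Fatou's lemma for the quotients \<open>Q n\<close>: their integrals telescope to the
  average of \<open>g\<close> over a short strip to the right of \<open>b\<close> minus the one to
  the right of \<open>a\<close>, which is at most \<open>u - l\<close>.\<close>

lemma nn_integral_derivative_mono_le:
  fixes g :: "real \<Rightarrow> real"
  assumes "mono g" and bounds: "\<And>x. l \<le> g x" "\<And>x. g x \<le> u" and "a \<le> b"
  shows "(\<integral>\<^sup>+x. ennreal (if g differentiable (at x) then vector_derivative g (at x) else 0) * indicator {a..b} x \<partial>lborel)
    \<le> ennreal (u - l)"
proof -
  define Q where "Q = (\<lambda>n x. (g (x + 1 / real (Suc n)) - g x) * real (Suc n))"
  have [measurable]: "g \<in> borel_measurable borel" by (rule borel_measurable_mono[OF assms(1)])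
  have Qm[measurable]: "Q n \<in> borel_measurable borel" for n unfolding Q_def by measurable
  have Q0: "Q n x \<ge> 0" for n x
    using monoD[OF assms(1), of x "x + 1 / real (Suc n)"] by (simp add: Q_def)
  have int: "g integrable_on {p..q}" for p q
    using assms(1) by (intro integrable_on_mono_on) (auto simp: mono_def mono_on_def)
  have QI: "(\<integral>\<^sup>+x. ennreal (Q n x) * indicator {a..b} x \<partial>lborel) \<le> ennreal (u - l)" for n
  proof -
    define h where "h = 1 / real (Suc n)"
    have h: "h > 0" by (simp add: h_def)
    have shift: "((\<lambda>x. g (x + h)) has_integral (integral {a+h..b+h} g)) {a..b}"
      using has_integral_affinity'[OF integrable_integral[OF int[of "a+h" "b+h"], folded cbox_interval], of 1 h]
      by simp
    \<comment> \<open>Both sides are the integral over \<open>{a..b+h}\<close>; cancelling leaves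
      only the two end strips.\<close>
    have "integral {a..a+h} g + integral {a+h..b+h} g = integral {a..b} g + integral {b..b+h} g"
      using h assms(4) by (subst (1 2) Henstock_Kurzweil_Integration.integral_combine) (auto intro: int)
    moreover have "integral {b..b+h} g \<le> h * u"
      using integral_le[OF int[of b "b+h"], of "\<lambda>_. u"] bounds h by (simp add: integrable_const_ivl)
    moreover have "h * l \<le> integral {a..a+h} g"
      using integral_le[OF _ int[of a "a+h"], of "\<lambda>_. l"] bounds h by (simp add: integrable_const_ivl)
    ultimately have le: "integral {a+h..b+h} g - integral {a..b} g \<le> h * (u - l)"
      by (simp add: algebra_simps)
    define I where "I = (integral {a+h..b+h} g - integral {a..b} g) * real (Suc n)"
    have "(Q n has_integral I) {a..b}"
      unfolding Q_def I_def h_def[symmetric]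
      by (intro has_integral_mult_left has_integral_diff shift integrable_integral int)
    then have "((\<lambda>x. Q n x * indicator {a..b} x) has_integral I) UNIV"
      using has_integral_indicator_UNIV[of "{a..b}" "Q n" I] by (simp only: mult.commute)
    then have "(\<integral>\<^sup>+x. ennreal (Q n x * indicator {a..b} x) \<partial>lborel) = ennreal I"
      using Q0 by (intro nn_integral_has_integral_lborel) (auto simp: indicator_def)
    moreover have "I \<le> u - l"
    proof -
      have "I \<le> h * (u - l) * real (Suc n)" unfolding I_def by (intro mult_right_mono le) auto
      also have "\<dots> = u - l" by (simp add: h_def)
      finally show ?thesis .
    qed
    moreover have "ennreal (Q n x * indicator {a..b} x) = ennreal (Q n x) * indicator {a..b} x" for x
      by (simp add: indicator_def)
    ultimately show ?thesis by (simp add: ennreal_leI)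
  qed
  have "(\<integral>\<^sup>+x. ennreal (if g differentiable (at x) then vector_derivative g (at x) else 0) * indicator {a..b} x \<partial>lborel)
     \<le> (\<integral>\<^sup>+x. liminf (\<lambda>n. ennreal (Q n x) * indicator {a..b} x) \<partial>lborel)"
  proof (rule nn_integral_mono)
    fix x
    show "ennreal (if g differentiable (at x) then vector_derivative g (at x) else 0) * indicator {a..b} x
      \<le> liminf (\<lambda>n. ennreal (Q n x) * indicator {a..b} x)"
    proof (cases "g differentiable (at x) \<and> x \<in> {a..b}")
      case True
      then have "(\<lambda>n. Q n x) \<longlonglongrightarrow> vector_derivative g (at x)"
        unfolding Q_def by (intro has_vector_derivative_LIMSEQ) (simp add: vector_derivative_works)
      then have "(\<lambda>n. ennreal (Q n x)) \<longlonglongrightarrow> ennreal (vector_derivative g (at x))" by simp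
      then show ?thesis using True by (simp add: lim_imp_Liminf)
    qed auto
  qed
  also have "\<dots> \<le> liminf (\<lambda>n. \<integral>\<^sup>+x. ennreal (Q n x) * indicator {a..b} x \<partial>lborel)"
    by (rule nn_integral_liminf) measurable
  also have "\<dots> \<le> ennreal (u - l)"
    by (rule Liminf_le) (use QI in auto)
  finally show ?thesis .
qed

text \<open>A bridge from Lebesgue integrability on the product, where Fubini applies, to iterated
  gauge integrals. The inner integrals are identified only for almost every \<open>v\<close>, so the
  outer statement follows after a change on a null set.\<close>

lemma
  fixes \<phi> :: "real \<Rightarrow> real \<Rightarrow> real"
  assumes "integrable (lborel \<Otimes>\<^sub>M lborel) (\<lambda>(u, v). indicator ({a..b} \<times> {c..d}) (u, v) * \<phi> u v)"
  shows iterated_integrable_inner: "AE v in lborel. v \<in> {c..d} \<longrightarrow> (\<lambda>u. \<phi> u v) integrable_on {a..b}"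
    and iterated_integrable_outer: "(\<lambda>v. integral {a..b} (\<lambda>u. \<phi> u v)) integrable_on {c..d}"
proof -
  define \<psi> where "\<psi> = (\<lambda>u v. indicator ({a..b} \<times> {c..d}) (u, v) * \<phi> u v)"
  have I: "integrable (lborel \<Otimes>\<^sub>M lborel) (case_prod \<psi>)" using assms by (simp add: \<psi>_def)
  have *: "((\<lambda>u. \<phi> u v) has_integral (\<integral>u. \<psi> u v \<partial>lborel)) {a..b}"
    if "integrable lborel (\<lambda>u. \<psi> u v)" "v \<in> {c..d}" for v
  proof -
    have "\<psi> u v = indicator {a..b} u * \<phi> u v" for u
      using that(2) by (auto simp: \<psi>_def indicator_def)
    then show ?thesis
      using has_integral_integral_lborel[OF that(1)] by (simp add: has_integral_indicator_UNIV)
  qed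
  have AE: "AE v in lborel. integrable lborel (\<lambda>u. \<psi> u v)"
    using lborel_pair.AE_integrable_snd[OF I] .
  then show "AE v in lborel. v \<in> {c..d} \<longrightarrow> (\<lambda>u. \<phi> u v) integrable_on {a..b}"
    by eventually_elim (use * in \<open>auto simp: integrable_on_def\<close>)
  have "(\<lambda>v. \<integral>u. \<psi> u v \<partial>lborel) integrable_on UNIV"
    using has_integral_integral_lborel[OF lborel_pair.integrable_snd[OF I]] by (auto simp: integrable_on_def)
  then have "(\<lambda>v. \<integral>u. \<psi> u v \<partial>lborel) integrable_on {c..d}"
    using integrable_on_subcbox[of _ UNIV c d] by simp
  then show "(\<lambda>v. integral {a..b} (\<lambda>u. \<phi> u v)) integrable_on {c..d}"
    by (rule integrable_spike[OF _ AE[unfolded AE_lborel_iff_negligible]])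
       (use * in \<open>auto simp: integral_unique\<close>)
qed

subsection \<open>Two-increasing functions on the plane\<close>

text \<open>Stated on the whole plane so that all derivatives are two-sided. The boundary conditions
  of a copula are replaced by the monotonicity and Lipschitz bounds that they imply; the intended
  instance is \<open>extend C\<close>.\<close>

locale two_increasing =
  fixes F :: "real \<Rightarrow> real \<Rightarrow> real"
  assumes two_increasing: "\<And>u u' v v'. u \<le> u' \<Longrightarrow> v \<le> v' \<Longrightarrow> F u v' + F u' v \<le> F u v + F u' v'"
    and mono2: "\<And>u v v'. v \<le> v' \<Longrightarrow> F u v \<le> F u v'"
    and Lipschitz2: "\<And>u v v'. v \<le> v' \<Longrightarrow> F u v' - F u v \<le> v' - v"
    and Lipschitz1: "\<And>u u' v. \<bar>F u v - F u' v\<bar> \<le> \<bar>u - u'\<bar>"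
begin

text \<open>Restricting to the countably many steps \<open>1 / Suc n\<close> keeps the upper limit
  measurable.\<close>

definition quot :: "nat \<Rightarrow> real \<Rightarrow> real \<Rightarrow> real" where
  "quot n u v = (F u (v + 1 / real (Suc n)) - F u v) * real (Suc n)"

text \<open>The upper derivative exists everywhere and, unlike the derivative, is monotone in \<open>u\<close> on the
  whole line.\<close>

definition upper_deriv :: "real \<Rightarrow> real \<Rightarrow> real" where
  "upper_deriv u v = real_of_ereal (limsup (\<lambda>n. ereal (quot n u v)))"

lemma quot_bounds: "0 \<le> quot n u v" "quot n u v \<le> 1"
proof -
  show "0 \<le> quot n u v" using mono2[of v "v + 1 / real (Suc n)" u] by (simp add: quot_def)
  have "(F u (v + 1 / real (Suc n)) - F u v) * real (Suc n) \<le> 1 / real (Suc n) * real (Suc n)"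
    using Lipschitz2[of v "v + 1 / real (Suc n)" u] by (intro mult_right_mono) auto
  then show "quot n u v \<le> 1" by (simp add: quot_def)
qed

lemma limsup_quot_bounds:
  "0 \<le> limsup (\<lambda>n. ereal (quot n u v))" "limsup (\<lambda>n. ereal (quot n u v)) \<le> 1"
proof -
  show "limsup (\<lambda>n. ereal (quot n u v)) \<le> 1"
    by (rule Limsup_bounded) (use quot_bounds in auto)
  have "0 \<le> liminf (\<lambda>n. ereal (quot n u v))"
    by (rule Liminf_bounded) (use quot_bounds in auto)
  then show "0 \<le> limsup (\<lambda>n. ereal (quot n u v))"
    using Liminf_le_Limsup[of sequentially "\<lambda>n. ereal (quot n u v)"] by (auto intro: order_trans)
qed

lemma upper_deriv_bounds: "0 \<le> upper_deriv u v" "upper_deriv u v \<le> 1"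
  using limsup_quot_bounds[of u v] real_of_ereal_pos[of "limsup (\<lambda>n. ereal (quot n u v))"]
    real_of_ereal_positive_mono[of "limsup (\<lambda>n. ereal (quot n u v))" 1]
  by (auto simp: upper_deriv_def)

text \<open>Being 2-increasing says that the increment of \<open>F\<close> between two heights grows
  with \<open>u\<close>; the upper limit of the quotients inherits this.\<close>

lemma mono_upper_deriv: "mono (\<lambda>u. upper_deriv u v)"
proof (rule monoI)
  fix u u' :: real assume "u \<le> u'"
  then have "quot n u v \<le> quot n u' v" for n
    unfolding quot_def using two_increasing[of u u' v "v + 1 / real (Suc n)"]
    by (intro mult_right_mono) auto
  then have "limsup (\<lambda>n. ereal (quot n u v)) \<le> limsup (\<lambda>n. ereal (quot n u' v))"
    by (intro Limsup_mono) auto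
  then show "upper_deriv u v \<le> upper_deriv u' v"
    unfolding upper_deriv_def using limsup_quot_bounds[of u v] limsup_quot_bounds[of u' v]
    by (intro real_of_ereal_positive_mono) auto
qed

lemma upper_deriv_eq:
  assumes "F u differentiable (at v)"
  shows "upper_deriv u v = vector_derivative (F u) (at v)"
proof -
  have "(\<lambda>n. quot n u v) \<longlonglongrightarrow> vector_derivative (F u) (at v)"
    unfolding quot_def using assms by (intro has_vector_derivative_LIMSEQ) (simp add: vector_derivative_works)
  then have "(\<lambda>n. ereal (quot n u v)) \<longlonglongrightarrow> ereal (vector_derivative (F u) (at v))" by simp
  from lim_imp_Limsup[OF sequentially_bot this] show ?thesis by (simp add: upper_deriv_def)
qed

lemma continuous_on_F: "continuous_on UNIV (\<lambda>(u, v). F u v)"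
proof (rule lipschitz_on_continuous_on[of 2], rule lipschitz_onI)
  fix p q :: "real \<times> real"
  obtain u v u' v' where pq: "p = (u, v)" "q = (u', v')" by (cases p; cases q)
  have "\<bar>F u' v - F u' v'\<bar> \<le> \<bar>v - v'\<bar>"
    using mono2[of v v' u'] mono2[of v' v u'] Lipschitz2[of v v' u'] Lipschitz2[of v' v u'] by linarith
  moreover have "\<bar>u - u'\<bar> \<le> dist p q" "\<bar>v - v'\<bar> \<le> dist p q"
    using dist_fst_le[of p q] dist_snd_le[of p q] by (auto simp: pq dist_real_def)
  ultimately show "dist (case p of (u, v) \<Rightarrow> F u v) (case q of (u, v) \<Rightarrow> F u v) \<le> 2 * dist p q"
    using Lipschitz1[of u v u'] by (simp add: pq dist_real_def)
qed simp

lemma continuous_on_F_comp: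
  assumes "continuous_on S f" "continuous_on S g"
  shows "continuous_on S (\<lambda>x. F (f x) (g x))"
  using continuous_on_compose2[OF continuous_on_F continuous_on_Pair[OF assms]] by simp

lemma borel_measurable_F [measurable]: "(\<lambda>(u, v). F u v) \<in> borel_measurable (borel \<Otimes>\<^sub>M borel)"
  using borel_measurable_continuous_onI[OF continuous_on_F] by (simp add: borel_prod)

lemma borel_measurable_F_comp [measurable]:
  assumes [measurable]: "f \<in> borel_measurable M" "g \<in> borel_measurable M"
  shows "(\<lambda>x. F (f x) (g x)) \<in> borel_measurable M"
  using measurable_compose[OF _ borel_measurable_F, of "\<lambda>x. (f x, g x)" M] by simp

lemma borel_measurable_upper_deriv:
  "(\<lambda>(v, u). upper_deriv u v) \<in> borel_measurable (borel \<Otimes>\<^sub>M borel)"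
  unfolding upper_deriv_def quot_def split_beta by measurable

text \<open>Differentiability holds at almost every \<open>v\<close> for each fixed
  \<open>u\<close>. Exchanging the quantifiers needs a measurable set of differentiability points in
  the product, which \<open>pred_differentiable_mono\<close> supplies.\<close>

lemma AE_differentiable2: "AE v in lborel. AE u in lborel. F u differentiable (at v)"
proof -
  have "Measurable.pred (borel \<Otimes>\<^sub>M borel) (\<lambda>(u, v). F u differentiable (at v))"
    by (rule pred_differentiable_mono) (auto intro: monoI mono2)
  then have "{p \<in> space (lborel \<Otimes>\<^sub>M lborel). F (fst p) differentiable (at (snd p))} \<in> sets (lborel \<Otimes>\<^sub>M lborel)"
    by (simp add: pred_def split_beta space_pair_measure cong: sets_pair_measure_cong)
  moreover have "AE v in lborel. F u differentiable (at v)" for u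
    using mono_Lipschitz_AE_differentiable[of "F u"] mono2 Lipschitz2 by (simp add: AE_completion_iff)
  ultimately show ?thesis
    by (subst lborel_pair.AE_commute[symmetric]) auto
qed

section \<open>The mixed derivative and its integrability\<close>

definition mixed_deriv :: "real \<Rightarrow> real \<Rightarrow> real" where
  "mixed_deriv u v = vector_derivative (\<lambda>s. upper_deriv s v) (at u)"

text \<open>The complement of \<open>E\<close> is null, so \<open>E\<close> is dense, and on
  \<open>E\<close> the inner derivative is the monotone \<open>upper_deriv\<close>. Hence exactly
  the same \<open>d\<close> are derivatives on both sides, and the values agree even where no such
  \<open>d\<close> exists.\<close>

lemma vector_derivative_within_differentiable_eq:
  assumes ae: "AE u in lborel. F u differentiable (at v)" and u: "F u differentiable (at v)"
  defines "E \<equiv> {s. F s differentiable (at v)}"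
  shows "vector_derivative (\<lambda>s. vector_derivative (F s) (at v)) (at u within E) = mixed_deriv u v"
proof -
  have "interior (- E) = {}"
  proof (rule ccontr)
    assume "interior (- E) \<noteq> {}"
    moreover have "negligible (interior (- E))"
      using ae unfolding AE_lborel_iff_negligible E_def Compl_eq
      by (rule negligible_subset) (use interior_subset in auto)
    ultimately show False using open_not_negligible[of "interior (- E)"] by simp
  qed
  then have dense: "closure E = UNIV" by (simp add: closure_interior)
  have "((\<lambda>s. vector_derivative (F s) (at v)) has_vector_derivative d) (at u within E) \<longleftrightarrow>
      ((\<lambda>s. upper_deriv s v) has_vector_derivative d) (at u)" for d
  proof -
    have "((\<lambda>s. vector_derivative (F s) (at v)) has_vector_derivative d) (at u within E) \<longleftrightarrow>
      ((\<lambda>s. upper_deriv s v) has_vector_derivative d) (at u within E)"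
      using u by (intro has_vector_derivative_cong_ev) (auto simp: E_def upper_deriv_eq)
    also have "\<dots> \<longleftrightarrow> ((\<lambda>s. upper_deriv s v) has_vector_derivative d) (at u)"
      using mono_derivative_from_dense[OF mono_upper_deriv dense] has_vector_derivative_at_within by blast
    finally show ?thesis .
  qed
  then show ?thesis by (simp add: mixed_deriv_def vector_derivative_def)
qed

text \<open>Where it exists, the mixed derivative is nonnegative with integral at most 1 over each
  horizontal section; elsewhere it is a constant. As \<open>X\<close> is bounded by 1, the section
  bound \<open>1 + J * (b - a)\<close> times the length of \<open>{c..d}\<close> suffices.\<close>

lemma integrable_mixed_deriv:
  assumes [measurable]: "case_prod X \<in> borel_measurable (borel \<Otimes>\<^sub>M borel)"
    and X: "\<And>u v. u \<in> {a..b} \<Longrightarrow> v \<in> {c..d} \<Longrightarrow> \<bar>X u v\<bar> \<le> 1" and "a \<le> b"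
  shows "integrable (lborel \<Otimes>\<^sub>M lborel)
    (\<lambda>(u, v). indicator ({a..b} \<times> {c..d}) (u, v) * (X u v * mixed_deriv u v))"
proof -
  \<comment> \<open>The absolute value of what \<open>vector_derivative\<close> returns where there
    is no derivative.\<close>
  define J :: real where "J = \<bar>SOME d. False\<bar>"
  let ?d = "\<lambda>v u. (\<lambda>s. upper_deriv s v) differentiable (at u)"
  define D where "D = (\<lambda>v u. if ?d v u then mixed_deriv u v else 0)"
  have m1: "(\<lambda>(v, u). mixed_deriv u v) \<in> borel_measurable (borel \<Otimes>\<^sub>M borel)"
    unfolding mixed_deriv_def
    by (rule borel_measurable_vector_derivative_mono) (auto intro: mono_upper_deriv borel_measurable_upper_deriv)
  have m2: "Measurable.pred (borel \<Otimes>\<^sub>M borel) (\<lambda>(v, u). ?d v u)"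
    by (rule pred_differentiable_mono) (auto intro: mono_upper_deriv borel_measurable_upper_deriv)
  have [measurable]: "(\<lambda>p. mixed_deriv (fst p) (snd p)) \<in> borel_measurable (borel \<Otimes>\<^sub>M borel)"
    using measurable_compose[OF _ m1, of "\<lambda>p. (snd p, fst p)"] by simp
  have [measurable]: "Measurable.pred (borel \<Otimes>\<^sub>M borel) (\<lambda>p. ?d (snd p) (fst p))"
    using measurable_compose[OF _ m2, of "\<lambda>p. (snd p, fst p)"] by simp
  have [measurable]: "(\<lambda>p. D (snd p) (fst p)) \<in> borel_measurable (borel \<Otimes>\<^sub>M borel)"
    unfolding D_def by measurable
  have mono_nn: "mixed_deriv u v \<ge> 0" if "?d v u" for u v
  proof (rule LIMSEQ_le_const)
    show "(\<lambda>n. (upper_deriv (u + 1 / real (Suc n)) v - upper_deriv u v) * real (Suc n)) \<longlonglongrightarrow> mixed_deriv u v"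
      unfolding mixed_deriv_def using that
      by (intro has_vector_derivative_LIMSEQ) (simp add: vector_derivative_works)
    show "\<exists>N. \<forall>n\<ge>N. 0 \<le> (upper_deriv (u + 1 / real (Suc n)) v - upper_deriv u v) * real (Suc n)"
      using monoD[OF mono_upper_deriv[of v]] by (auto intro!: exI[of _ 0] mult_nonneg_nonneg)
  qed
  have bound: "\<bar>mixed_deriv u v\<bar> \<le> D v u + J" for u v
  proof (cases "?d v u")
    case False
    then have "\<not> ((\<lambda>s. upper_deriv s v) has_vector_derivative e) (at u)" for e
      using differentiableI_vector by blast
    with False show ?thesis by (simp add: mixed_deriv_def D_def J_def vector_derivative_def)
  qed (use mono_nn in \<open>simp add: D_def J_def\<close>)
  have inner: "(\<integral>\<^sup>+u. ennreal (D v u) * indicator {a..b} u \<partial>lborel) \<le> 1" for v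
    using nn_integral_derivative_mono_le[OF mono_upper_deriv[of v] upper_deriv_bounds(1) upper_deriv_bounds(2) \<open>a \<le> b\<close>]
    unfolding D_def mixed_deriv_def by simp
  have sec[measurable]: "(\<lambda>u. D v u) \<in> borel_measurable borel" for v
    using measurable_compose[of "\<lambda>u. (u, v)" borel "borel \<Otimes>\<^sub>M borel" "\<lambda>p. D (snd p) (fst p)"] by simp
  show ?thesis
  proof (rule integrableI_bounded)
    have "(\<integral>\<^sup>+p. norm (case p of (u, v) \<Rightarrow> indicator ({a..b} \<times> {c..d}) (u, v) * (X u v * mixed_deriv u v)) \<partial>(lborel \<Otimes>\<^sub>M lborel))
      \<le> (\<integral>\<^sup>+p. (case p of (u, v) \<Rightarrow> (ennreal (D v u) + ennreal J) * indicator {a..b} u * indicator {c..d} v) \<partial>(lborel \<Otimes>\<^sub>M lborel))"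
    proof (rule nn_integral_mono, clarify)
      fix u v :: real
      show "ennreal (norm (indicator ({a..b} \<times> {c..d}) (u, v) * (X u v * mixed_deriv u v)))
        \<le> (ennreal (D v u) + ennreal J) * indicator {a..b} u * indicator {c..d} v"
      proof (cases "u \<in> {a..b} \<and> v \<in> {c..d}")
        case True
        have "\<bar>X u v * mixed_deriv u v\<bar> \<le> 1 * (D v u + J)"
          unfolding abs_mult using True by (intro mult_mono X bound) auto
        moreover have "D v u \<ge> 0" "J \<ge> 0" using mono_nn by (auto simp: D_def J_def)
        ultimately show ?thesis
          using True by (simp add: ennreal_plus[symmetric] ennreal_leI del: ennreal_plus)
      qed (auto simp: indicator_def)
    qed
    also have "\<dots> = (\<integral>\<^sup>+v. \<integral>\<^sup>+u. (ennreal (D v u) + ennreal J) * indicator {a..b} u * indicator {c..d} v \<partial>lborel \<partial>lborel)"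
      by (subst lborel_pair.nn_integral_snd[symmetric]) (auto simp: split_beta)
    also have "\<dots> \<le> (\<integral>\<^sup>+v. (1 + ennreal J * ennreal (b - a)) * indicator {c..d} v \<partial>lborel)"
    proof (rule nn_integral_mono)
      fix v :: real
      have "(\<integral>\<^sup>+u. (ennreal (D v u) + ennreal J) * indicator {a..b} u * indicator {c..d} v \<partial>lborel)
        = (\<integral>\<^sup>+u. (ennreal (D v u) + ennreal J) * indicator {a..b} u \<partial>lborel) * indicator {c..d} v"
        by (rule nn_integral_multc) measurable
      also have "(\<integral>\<^sup>+u. (ennreal (D v u) + ennreal J) * indicator {a..b} u \<partial>lborel)
        = (\<integral>\<^sup>+u. ennreal (D v u) * indicator {a..b} u \<partial>lborel) + (\<integral>\<^sup>+u. ennreal J * indicator {a..b} u \<partial>lborel)"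
        by (simp add: distrib_right nn_integral_add)
      also have "(\<integral>\<^sup>+u. ennreal J * indicator {a..b} u \<partial>lborel) = ennreal J * ennreal (b - a)"
        using \<open>a \<le> b\<close> by (simp add: nn_integral_cmult_indicator)
      finally show "(\<integral>\<^sup>+u. (ennreal (D v u) + ennreal J) * indicator {a..b} u * indicator {c..d} v \<partial>lborel)
        \<le> (1 + ennreal J * ennreal (b - a)) * indicator {c..d} v"
        using inner[of v] by (simp add: mult_right_mono add_right_mono)
    qed
    also have "\<dots> < \<infinity>"
      by (auto simp: nn_integral_cmult_indicator ennreal_mult_less_top emeasure_lborel_Icc_eq ennreal_mult[symmetric])
    finally show "(\<integral>\<^sup>+p. norm (case p of (u, v) \<Rightarrow> indicator ({a..b} \<times> {c..d}) (u, v) * (X u v * mixed_deriv u v)) \<partial>(lborel \<Otimes>\<^sub>M lborel)) < \<infinity>" .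
  qed (simp add: split_beta)
qed

end

subsection \<open>Mixed partial derivatives of copulas\<close>

lemma is_copulaD:
  assumes "is_copula C"
  shows copula_bounds: "u \<in> {0..1} \<Longrightarrow> v \<in> {0..1} \<Longrightarrow> 0 \<le> C u v \<and> C u v \<le> 1"
    and copula_margins: "u \<in> {0..1} \<Longrightarrow> C u 0 = 0" "u \<in> {0..1} \<Longrightarrow> C u 1 = u"
      "v \<in> {0..1} \<Longrightarrow> C 0 v = 0" "v \<in> {0..1} \<Longrightarrow> C 1 v = v"
    and copula_two_increasing: "0 \<le> u \<Longrightarrow> u \<le> u' \<Longrightarrow> u' \<le> 1 \<Longrightarrow> 0 \<le> v \<Longrightarrow> v \<le> v' \<Longrightarrow> v' \<le> 1 \<Longrightarrow>
      C u v' + C u' v \<le> C u v + C u' v'"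
proof -
  show "C u v' + C u' v \<le> C u v + C u' v'"
    if "0 \<le> u" "u \<le> u'" "u' \<le> 1" "0 \<le> v" "v \<le> v'" "v' \<le> 1"
  proof -
    have "C u v + C u' v' - C u v' - C u' v \<ge> 0" using assms that unfolding is_copula_def by blast
    then show ?thesis by linarith
  qed
qed (use assms in \<open>auto simp: is_copula_def\<close>)

section \<open>Extension of a copula to the plane\<close>

definition clip :: "real \<Rightarrow> real" where
  "clip x = max 0 (min 1 x)"

lemma clip_simps: "0 \<le> clip x" "clip x \<le> 1" "x \<in> {0..1} \<Longrightarrow> clip x = x"
  by (auto simp: clip_def)

lemma clip_mono: "x \<le> y \<Longrightarrow> clip x \<le> clip y" "x \<le> y \<Longrightarrow> clip y - clip x \<le> y - x"
  by (auto simp: clip_def)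

text \<open>Constant continuation across each edge of the square. Since \<open>clip\<close> is
  monotone and 1-Lipschitz, the inequalities for a copula survive.\<close>

definition extend :: "(real \<Rightarrow> real \<Rightarrow> real) \<Rightarrow> real \<Rightarrow> real \<Rightarrow> real" where
  "extend C u v = C (clip u) (clip v)"

lemma extend_eq [simp]: "u \<in> {0..1} \<Longrightarrow> v \<in> {0..1} \<Longrightarrow> extend C u v = C u v"
  by (simp add: extend_def clip_simps)

text \<open>Rectangles reaching the boundary give the bounds: an edge at \<open>u = 0\<close> yields
  monotonicity in \<open>v\<close>, an edge at \<open>u = 1\<close> the Lipschitz bound in
  \<open>v\<close>, and edges at \<open>v = 0\<close> and \<open>v = 1\<close> the Lipschitz bound
  in \<open>u\<close>.\<close>

lemma two_increasing_extend:
  assumes "is_copula C"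
  shows "two_increasing (extend C)"
proof
  note inc = copula_two_increasing[OF assms]
  note marg = copula_margins[OF assms]
  fix u u' v v' :: real
  show "extend C u v' + extend C u' v \<le> extend C u v + extend C u' v'" if "u \<le> u'" "v \<le> v'"
    unfolding extend_def using that by (intro inc clip_simps clip_mono)
  show "extend C u v \<le> extend C u v'" if "v \<le> v'"
    using inc[of 0 "clip u" "clip v" "clip v'"] marg(3)[of "clip v"] marg(3)[of "clip v'"] that
    by (simp add: extend_def clip_simps clip_mono(1))
  show "extend C u v' - extend C u v \<le> v' - v" if "v \<le> v'"
    using inc[of "clip u" 1 "clip v" "clip v'"] marg(4)[of "clip v"] marg(4)[of "clip v'"] that clip_mono(2)[OF that]
    by (simp add: extend_def clip_simps clip_mono(1))
  have "\<bar>extend C x v - extend C y v\<bar> \<le> \<bar>x - y\<bar>" if "x \<le> y" for x y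
    using inc[of "clip x" "clip y" 0 "clip v"] inc[of "clip x" "clip y" "clip v" 1]
      marg(1,2)[of "clip x"] marg(1,2)[of "clip y"] that clip_mono(2)[OF that]
    by (simp add: extend_def clip_simps clip_mono(1))
  from this[of u u'] this[of u' u] show "\<bar>extend C u v - extend C u' v\<bar> \<le> \<bar>u - u'\<bar>"
    by (cases "u \<le> u'") auto
qed

text \<open>Only \<open>v\<close> varies, so an interior \<open>v\<close> suffices: near it, the
  restriction to the unit interval is invisible and \<open>C u\<close> equals its extension, even
  for \<open>u\<close> on the boundary.\<close>

lemma has_partial_v_iff:
  assumes "u \<in> {0..1}" "v \<in> {0<..<1}"
  shows "((\<lambda>w. C u w) has_vector_derivative d) (at v within {0..1}) \<longleftrightarrow>
    (extend C u has_vector_derivative d) (at v)"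
proof -
  have "at v within {0..1} = at v" using assms by (intro at_within_Icc_at) auto
  moreover have "\<forall>\<^sub>F w in nhds v. w \<in> {0<..<1}"
    using assms(2) by (intro eventually_nhds_in_open) auto
  then have "\<forall>\<^sub>F w in nhds v. w \<in> UNIV \<longrightarrow> C u w = extend C u w"
    by eventually_elim (use assms in auto)
  ultimately show ?thesis
    using has_vector_derivative_cong_ev[of UNIV "C u" "extend C u" v d] assms by simp
qed

lemma partial_v_eq:
  "u \<in> {0..1} \<Longrightarrow> v \<in> {0<..<1} \<Longrightarrow> partial_v C u v = vector_derivative (extend C u) (at v)"
  by (simp add: partial_v_def vector_derivative_def has_partial_v_iff)

lemma differentiable_iff_ex_vector_derivative:
  fixes f :: "real \<Rightarrow> 'a::real_normed_vector"
  shows "f differentiable F \<longleftrightarrow> (\<exists>d. (f has_vector_derivative d) F)"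
  by (metis vector_derivative_works differentiableI_vector)

lemma partial_v_dom_eq:
  "v \<in> {0<..<1} \<Longrightarrow> partial_v_dom C v = {0..1} \<inter> {u. extend C u differentiable (at v)}"
  by (auto simp: partial_v_dom_def differentiable_iff_ex_vector_derivative has_partial_v_iff)

text \<open>At interior points the restrictions to the unit interval disappear locally. What remains
  is a derivative within the set where the inner derivative exists, and that one is already
  computed.\<close>

lemma mixed_partial_eq_mixed_deriv:
  assumes C: "is_copula C" and v: "v \<in> {0<..<1}" and u: "u \<in> {0<..<1}"
    and ae: "AE u in lborel. extend C u differentiable (at v)"
    and diff: "extend C u differentiable (at v)"
  shows "mixed_partial C u v = two_increasing.mixed_deriv (extend C) u v"
proof -
  let ?E = "{u. extend C u differentiable (at v)}"
  have "mixed_partial C u v = vector_derivative (\<lambda>s. vector_derivative (extend C s) (at v)) (at u within {0..1} \<inter> ?E)"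
    unfolding mixed_partial_def partial_v_dom_eq[OF v]
    by (rule vector_derivative_cong_eq) (use u v diff in \<open>auto simp: partial_v_eq\<close>)
  also have "at u within {0..1} \<inter> ?E = at u within ?E"
    by (rule at_within_nhd[of _ "{0<..<1}"]) (use u in auto)
  finally show ?thesis
    using two_increasing.vector_derivative_within_differentiable_eq[OF two_increasing_extend[OF C] ae diff] by simp
qed

section \<open>Effect of adding a multiple of \<open>M - W\<close> on the mixed derivative\<close>

lemma has_vector_derivative_M_minus_W:
  assumes "s \<noteq> v" "s \<noteq> 1 - v"
  shows "((\<lambda>w. M_cop s w - W_cop s w) has_vector_derivative
    ((if v < s then 1 else 0) - (if 1 < s + v then 1 else 0))) (at v within T)"
proof (intro has_vector_derivative_diff)
  consider "v < s" | "s < v" using assms by linarith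
  then have "(M_cop s has_vector_derivative (if v < s then 1 else 0)) (at v)"
  proof cases
    case 1
    then have "\<forall>\<^sub>F w in nhds v. w \<in> UNIV \<longrightarrow> w = M_cop s w"
      using eventually_nhds_in_open[of "{..<s}" v] by (auto elim!: eventually_mono simp: M_cop_def)
    then show ?thesis
      using 1 has_vector_derivative_cong_ev[of UNIV "\<lambda>w. w" "M_cop s" v 1] by (simp add: M_cop_def)
  next
    case 2
    then have "\<forall>\<^sub>F w in nhds v. w \<in> UNIV \<longrightarrow> s = M_cop s w"
      using eventually_nhds_in_open[of "{s<..}" v] by (auto elim!: eventually_mono simp: M_cop_def)
    then show ?thesis
      using 2 has_vector_derivative_cong_ev[of UNIV "\<lambda>w. s" "M_cop s" v 0] by (simp add: M_cop_def)
  qed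
  then show "((\<lambda>w. M_cop s w) has_vector_derivative (if v < s then 1 else 0)) (at v within T)"
    by (rule has_vector_derivative_at_within)
  consider "v < 1 - s" | "1 - s < v" using assms by linarith
  then have "(W_cop s has_vector_derivative (if 1 < s + v then 1 else 0)) (at v)"
  proof cases
    case 1
    then have "\<forall>\<^sub>F w in nhds v. w \<in> UNIV \<longrightarrow> 0 = W_cop s w"
      using eventually_nhds_in_open[of "{..<1-s}" v] by (auto elim!: eventually_mono simp: W_cop_def)
    then show ?thesis
      using 1 has_vector_derivative_cong_ev[of UNIV "\<lambda>w. 0" "W_cop s" v 0] by (simp add: W_cop_def)
  next
    case 2
    then have "\<forall>\<^sub>F w in nhds v. w \<in> UNIV \<longrightarrow> s + w - 1 = W_cop s w"
      using eventually_nhds_in_open[of "{1-s<..}" v] by (auto elim!: eventually_mono simp: W_cop_def)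
    moreover have "((\<lambda>w. s + w - 1) has_vector_derivative 1) (at v)"
      by (auto intro!: derivative_eq_intros)
    ultimately show ?thesis
      using 2 has_vector_derivative_cong_ev[of UNIV "\<lambda>w. s + w - 1" "W_cop s" v 1] by (simp add: W_cop_def)
  qed
  then show "((\<lambda>w. W_cop s w) has_vector_derivative (if 1 < s + v then 1 else 0)) (at v within T)"
    by (rule has_vector_derivative_at_within)
qed

text \<open>Away from the two diagonals, the \<open>v\<close>-derivative of \<open>M - W\<close> is locally constant in \<open>u\<close>.\<close>

lemma mixed_partial_C_alpha:
  assumes u: "u \<in> partial_v_dom C v" and "u \<noteq> v" "u \<noteq> 1 - v" and v: "v \<in> {0<..<1}"
  shows "mixed_partial (C_alpha C \<alpha>) u v = mixed_partial C u v"
proof -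
  \<comment> \<open>\<open>B\<close> collects the \<open>s\<close> on the same side of both
    diagonals as \<open>u\<close>; products encode equal strict signs and make \<open>B\<close>
    visibly open. Below, \<open>k\<close> is the common slope in \<open>v\<close> of the added term
    for all these \<open>s\<close>.\<close>
  define B where "B = {s. 0 < (s - v) * (u - v)} \<inter> {s. 0 < (s + v - 1) * (u + v - 1)}"
  define k where "k = \<alpha> / 2 * ((if v < u then 1 else 0) - (if 1 < u + v then 1 else 0))"
  have "open B" unfolding B_def by (intro open_Int open_Collect_less continuous_intros)
  have "u \<in> B"
    using assms(2,3) by (auto simp: B_def zero_less_mult_iff)
  have L: "((\<lambda>w. \<alpha> / 2 * (M_cop s w - W_cop s w)) has_vector_derivative k) (at v within {0..1})" if "s \<in> B" for s
  proof -
    have "s \<noteq> v" "s \<noteq> 1 - v" "v < s \<longleftrightarrow> v < u" "1 < s + v \<longleftrightarrow> 1 < u + v"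
      using that by (auto simp: B_def zero_less_mult_iff)
    then show ?thesis
      using has_vector_derivative_mult_right[OF has_vector_derivative_M_minus_W[of s v "{0..1}"], of "\<alpha>/2"]
      by (simp add: k_def)
  qed
  have shift: "((\<lambda>w. C_alpha C \<alpha> s w) has_vector_derivative d + k) (at v within {0..1}) \<longleftrightarrow>
      ((\<lambda>w. C s w) has_vector_derivative d) (at v within {0..1})" if "s \<in> B" for s d
    using has_vector_derivative_add[OF _ L[OF that], of "C s" d]
      has_vector_derivative_diff[OF _ L[OF that], of "\<lambda>w. C_alpha C \<alpha> s w" "d + k"]
    by (auto simp: C_alpha_def)
  \<comment> \<open>Near \<open>u\<close> both outer derivatives are therefore taken within the same
    set, of functions differing by the constant \<open>k\<close>.\<close>
  have dom: "partial_v_dom (C_alpha C \<alpha>) v \<inter> B = partial_v_dom C v \<inter> B"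
  proof -
    have "C_alpha C \<alpha> s differentiable (at v within {0..1}) \<longleftrightarrow> C s differentiable (at v within {0..1})"
      if "s \<in> B" for s
      unfolding differentiable_iff_ex_vector_derivative using shift[OF that] by (metis diff_add_cancel)
    then show ?thesis by (auto simp: partial_v_dom_def)
  qed
  have near: "at u within A = at u within A \<inter> B" for A
    by (rule at_within_nhd[OF \<open>u \<in> B\<close> \<open>open B\<close>]) auto
  have eq: "partial_v (C_alpha C \<alpha>) s v = partial_v C s v + k" if "s \<in> partial_v_dom C v \<inter> B" for s
  proof -
    have s: "s \<in> {0..1}" "s \<in> B" "((\<lambda>w. C s w) has_vector_derivative partial_v C s v) (at v within {0..1})"
      using that by (auto simp: partial_v_dom_def partial_v_def vector_derivative_works)
    \<comment> \<open>Uniqueness of the derivative needs a nontrivial filter.\<close>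
    have "at v within {0..1} \<noteq> bot" using v by (simp add: at_within_Icc_at)
    then show ?thesis
      unfolding partial_v_def[of "C_alpha C \<alpha>"]
      using s(3) shift[OF s(2)] by (intro vector_derivative_within) auto
  qed
  have "((\<lambda>s. partial_v (C_alpha C \<alpha>) s v) has_vector_derivative d) (at u within partial_v_dom (C_alpha C \<alpha>) v) \<longleftrightarrow>
      ((\<lambda>s. partial_v C s v) has_vector_derivative d) (at u within partial_v_dom C v)" for d
  proof -
    let ?T = "partial_v_dom C v \<inter> B"
    have "((\<lambda>s. partial_v (C_alpha C \<alpha>) s v) has_vector_derivative d) (at u within ?T) \<longleftrightarrow>
        ((\<lambda>s. partial_v C s v + k) has_vector_derivative d) (at u within ?T)"
      using u \<open>u \<in> B\<close> eq by (intro has_vector_derivative_cong_ev) (auto intro: always_eventually)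
    also have "\<dots> \<longleftrightarrow> ((\<lambda>s. partial_v C s v) has_vector_derivative d) (at u within ?T)"
      using has_vector_derivative_add[of "\<lambda>s. partial_v C s v" d "at u within ?T" "\<lambda>_. k" 0]
        has_vector_derivative_diff[of "\<lambda>s. partial_v C s v + k" d "at u within ?T" "\<lambda>_. k" 0] by auto
    finally show ?thesis
      using near[of "partial_v_dom (C_alpha C \<alpha>) v"] near[of "partial_v_dom C v"] dom by simp
  qed
  then show ?thesis by (simp add: mixed_partial_def vector_derivative_def)
qed

subsection \<open>The measures of dependency\<close>

lemma has_integral_min_const:
  assumes "c \<in> {0..1::real}"
  shows "((\<lambda>u. min u c) has_integral (c - c\<^sup>2 / 2)) {0..1}"
proof -
  have "((\<lambda>u. min u c) has_integral (c\<^sup>2 - 0\<^sup>2) / 2) {0..c}"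
    by (rule has_integral_eq[OF _ ident_has_integral]) (use assms in auto)
  moreover have "((\<lambda>_. c) has_integral (1 - c) *\<^sub>R c) {c..1}"
    using has_integral_const_real[of c c 1] assms by simp
  then have "((\<lambda>u. min u c) has_integral (1 - c) *\<^sub>R c) {c..1}"
    by (rule has_integral_eq[rotated]) auto
  ultimately have "((\<lambda>u. min u c) has_integral (c\<^sup>2 - 0\<^sup>2) / 2 + (1 - c) *\<^sub>R c) {0..1}"
    using assms by (intro has_integral_combine[of 0 c 1]) auto
  then show ?thesis by (simp add: field_simps power2_eq_square)
qed

lemma has_integral_M_minus_W:
  assumes "v \<in> {0..1}"
  shows "((\<lambda>u. M_cop u v - W_cop u v) has_integral (v - v\<^sup>2)) {0..1}"
proof -
  \<comment> \<open>Rewriting \<open>W\<close> through a minimum reduces the integral to minima with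
    a constant.\<close>
  have W: "M_cop u v - W_cop u v = min u v - (u - min u (1 - v))" for u
    by (auto simp: M_cop_def W_cop_def)
  have "((\<lambda>u. min u v - (u - min u (1 - v))) has_integral
      (v - v\<^sup>2/2 - ((1\<^sup>2 - 0\<^sup>2) / 2 - ((1 - v) - (1 - v)\<^sup>2 / 2)))) {0..1}"
    using assms by (intro has_integral_diff has_integral_min_const ident_has_integral) auto
  then show ?thesis unfolding W by (rule has_integral_eq_rhs) (simp add: field_simps power2_eq_square)
qed

lemma has_integral_diagonals_M_minus_W:
  "((\<lambda>u. (M_cop u u - W_cop u u) + (M_cop u (1 - u) - W_cop u (1 - u))) has_integral (1/2)) {0..1}"
proof -
  \<comment> \<open>On either diagonal \<open>M - W\<close> is the tent function
    \<open>min u (1 - u)\<close>.\<close>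
  have eq: "(M_cop u u - W_cop u u) + (M_cop u (1 - u) - W_cop u (1 - u)) = 2 * min u (1 - u)" for u
    by (auto simp: M_cop_def W_cop_def)
  have "((\<lambda>u::real. 2 * u) has_integral 2 * (((1/2)\<^sup>2 - 0\<^sup>2) / 2)) {0..1/2}"
    by (intro has_integral_mult_right ident_has_integral) simp
  then have left: "((\<lambda>u::real. 2 * min u (1 - u)) has_integral 2 * (((1/2)\<^sup>2 - 0\<^sup>2) / 2)) {0..1/2}"
    by (rule has_integral_eq[rotated]) auto
  have "((\<lambda>u::real. 2 * (1 - u)) has_integral 2 * (1/2 - (1\<^sup>2 - (1/2)\<^sup>2) / 2)) {1/2..1}"
    using has_integral_const_real[of "1::real" "1/2" 1]
    by (intro has_integral_mult_right has_integral_diff ident_has_integral) auto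
  then have right: "((\<lambda>u::real. 2 * min u (1 - u)) has_integral 2 * (1/2 - (1\<^sup>2 - (1/2)\<^sup>2) / 2)) {1/2..1}"
    by (rule has_integral_eq[rotated]) auto
  have "((\<lambda>u::real. 2 * min u (1 - u)) has_integral
      (2 * (((1/2)\<^sup>2 - 0\<^sup>2) / 2) + 2 * (1/2 - (1\<^sup>2 - (1/2)\<^sup>2) / 2))) {0..1}"
    by (rule has_integral_combine[OF _ _ left right]) auto
  then show ?thesis unfolding eq by (rule has_integral_eq_rhs) (simp add: power2_eq_square)
qed

lemma spearman_rho_C_alpha:
  assumes "is_copula C"
  shows "spearman_rho (C_alpha C \<alpha>) = spearman_rho C + \<alpha>"
proof -
  interpret two_increasing "extend C" by (rule two_increasing_extend[OF assms])
  have int: "(\<lambda>u. C u v) integrable_on {0..1}" if "v \<in> {0..1}" for v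
  proof -
    have "continuous_on {0..1} (\<lambda>u. extend C u v)"
      by (intro continuous_on_F_comp continuous_intros)
    then have "(\<lambda>u. extend C u v) integrable_on {0..1}" by (rule integrable_continuous_real)
    then show ?thesis by (rule integrable_eq) (use that in auto)
  qed
  \<comment> \<open>Monotonicity in \<open>v\<close> is enough for integrability of the outer
    integrand.\<close>
  have "mono_on {0..1} (\<lambda>v. integral {0..1} (\<lambda>u. C u v))"
  proof (rule mono_onI)
    fix v v' :: real assume vv: "v \<in> {0..1}" "v' \<in> {0..1}" "v \<le> v'"
    have "C u v \<le> C u v'" if "u \<in> {0..1}" for u
      using mono2[OF vv(3), of u] vv that by simp
    then show "integral {0..1} (\<lambda>u. C u v) \<le> integral {0..1} (\<lambda>u. C u v')"
      by (intro integral_le int vv) auto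
  qed
  then have out: "(\<lambda>v. integral {0..1} (\<lambda>u. C u v)) integrable_on {0..1}"
    by (rule integrable_on_mono_on)
  have "((\<lambda>v::real. v - v\<^sup>2) has_integral (1\<^sup>2 - 0\<^sup>2) / 2 - (1^Suc 2 / real (Suc 2) - 0^Suc 2 / real (Suc 2))) {0..1}"
    by (intro has_integral_diff ident_has_integral fundamental_theorem_of_calculus)
       (auto intro!: derivative_eq_intros simp: has_real_derivative_iff_has_vector_derivative[symmetric])
  \<comment> \<open>The shift of rho comes out as
    \<open>12 * (\<alpha> / 2) * (1/6) = \<alpha>\<close>.\<close>
  then have sq: "((\<lambda>v::real. v - v\<^sup>2) has_integral (1/6)) {0..1}" by simp
  have "integral {0..1} (\<lambda>v. integral {0..1} (\<lambda>u. C_alpha C \<alpha> u v))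
      = integral {0..1} (\<lambda>v. integral {0..1} (\<lambda>u. C u v) + \<alpha> / 2 * (v - v\<^sup>2))"
  proof (rule integral_cong)
    fix v :: real assume v: "v \<in> {0..1}"
    have "((\<lambda>u. C_alpha C \<alpha> u v) has_integral (integral {0..1} (\<lambda>u. C u v) + \<alpha> / 2 * (v - v\<^sup>2))) {0..1}"
      unfolding C_alpha_def
      by (intro has_integral_add has_integral_mult_right has_integral_M_minus_W v integrable_integral int)
    then show "integral {0..1} (\<lambda>u. C_alpha C \<alpha> u v) = integral {0..1} (\<lambda>u. C u v) + \<alpha> / 2 * (v - v\<^sup>2)"
      by (rule integral_unique)
  qed
  also have "\<dots> = integral {0..1} (\<lambda>v. integral {0..1} (\<lambda>u. C u v)) + \<alpha> / 2 * (1/6)"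
    by (intro integral_unique has_integral_add has_integral_mult_right sq integrable_integral out)
  finally show ?thesis by (simp add: spearman_rho_def)
qed

text \<open>At the centre of the square \<open>M - W\<close> is \<open>1/2\<close>, and
  \<open>4 * (\<alpha> / 2) * (1/2) = \<alpha>\<close>.\<close>

lemma blomqvist_beta_C_alpha: "blomqvist_beta (C_alpha C \<alpha>) = blomqvist_beta C + \<alpha>"
  by (simp add: blomqvist_beta_def C_alpha_def M_cop_def W_cop_def)

lemma gini_gamma_C_alpha:
  assumes "is_copula C"
  shows "gini_gamma (C_alpha C \<alpha>) = gini_gamma C + \<alpha>"
proof -
  interpret two_increasing "extend C" by (rule two_increasing_extend[OF assms])
  have "continuous_on {0..1} (\<lambda>u. extend C u u + extend C u (1 - u) - u)"
    by (intro continuous_on_F_comp continuous_intros)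
  then have "(\<lambda>u. extend C u u + extend C u (1 - u) - u) integrable_on {0..1}"
    by (rule integrable_continuous_real)
  then have int: "(\<lambda>u. C u u + C u (1 - u) - u) integrable_on {0..1}"
    by (rule integrable_eq) auto
  have "integral {0..1} (\<lambda>u. C_alpha C \<alpha> u u + C_alpha C \<alpha> u (1 - u) - u)
    = integral {0..1} (\<lambda>u. (C u u + C u (1 - u) - u) +
        \<alpha> / 2 * ((M_cop u u - W_cop u u) + (M_cop u (1 - u) - W_cop u (1 - u))))"
    by (rule integral_cong) (simp add: C_alpha_def algebra_simps)
  also have "\<dots> = integral {0..1} (\<lambda>u. C u u + C u (1 - u) - u) + \<alpha> / 2 * (1/2)"
    by (intro integral_unique has_integral_add has_integral_mult_right has_integral_diagonals_M_minus_W
        integrable_integral int)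
  finally show ?thesis by (simp add: gini_gamma_def)
qed

text \<open>Almost everywhere the integrand is \<open>C + \<alpha> / 2 * (M - W)\<close> times one
  common mixed derivative, and \<open>4 * (\<alpha> / 2) = 2 * \<alpha>\<close>. Splitting is done
  with \<open>mixed_deriv\<close>, for which both summands are integrable, and the result is carried
  back across null sets.\<close>

lemma kendall_tau_C_alpha:
  assumes C: "is_copula C"
  shows "kendall_tau (C_alpha C \<alpha>) = kendall_tau C +
    2 * \<alpha> * integral {0..1} (\<lambda>v. integral {0..1} (\<lambda>u. (M_cop u v - W_cop u v) * mixed_partial C u v))"
proof -
  interpret two_increasing "extend C" by (rule two_increasing_extend[OF C])
  let ?K = mixed_deriv and ?L = "\<lambda>u v. M_cop u v - W_cop u v"
  let ?P = "\<lambda>v. integral {0..1} (\<lambda>u. extend C u v * ?K u v)"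
  let ?R = "\<lambda>v. integral {0..1} (\<lambda>u. ?L u v * ?K u v)"
  \<comment> \<open>Both multipliers, \<open>extend C\<close> here and \<open>M - W\<close> next,
    are bounded by 1 on the unit square.\<close>
  have IP: "integrable (lborel \<Otimes>\<^sub>M lborel) (\<lambda>(u, v). indicator ({0..1} \<times> {0..1}) (u, v) * (extend C u v * ?K u v))"
    by (rule integrable_mixed_deriv) (use copula_bounds[OF C] in \<open>auto\<close>)
  have IR: "integrable (lborel \<Otimes>\<^sub>M lborel) (\<lambda>(u, v). indicator ({0..1} \<times> {0..1}) (u, v) * (?L u v * ?K u v))"
    by (rule integrable_mixed_deriv) (auto simp: M_cop_def W_cop_def)
  \<comment> \<open>The heights \<open>v\<close> failing this form the null set \<open>N\<close>,
    which the outer integrals ignore.\<close>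
  have "AE v in lborel. v \<noteq> 0 \<and> v \<noteq> 1 \<and> (AE u in lborel. extend C u differentiable (at v)) \<and>
      (v \<in> {0..1} \<longrightarrow> (\<lambda>u. extend C u v * ?K u v) integrable_on {0..1}) \<and>
      (v \<in> {0..1} \<longrightarrow> (\<lambda>u. ?L u v * ?K u v) integrable_on {0..1})"
    using AE_lborel_singleton[of 0] AE_lborel_singleton[of 1] AE_differentiable2
      iterated_integrable_inner[OF IP] iterated_integrable_inner[OF IR]
    by eventually_elim auto
  from this[THEN AE_lborel_iff_negligible[THEN iffD1]] obtain N where N: "negligible N" and good: "\<And>v. v \<in> {0..1} - N \<Longrightarrow>
      v \<in> {0<..<1} \<and> (AE u in lborel. extend C u differentiable (at v)) \<and>
      (\<lambda>u. extend C u v * ?K u v) integrable_on {0..1} \<and> (\<lambda>u. ?L u v * ?K u v) integrable_on {0..1}"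
    by (rule that) (auto simp: less_le)
  have outer: "?P integrable_on {0..1}" "?R integrable_on {0..1}"
    using iterated_integrable_outer[OF IP] iterated_integrable_outer[OF IR] .
  have mp: "negligible {u. \<not> (u \<in> {0..1} \<longrightarrow> mixed_partial C u v = ?K u v \<and> mixed_partial (C_alpha C \<alpha>) u v = ?K u v)}"
    if v: "v \<in> {0..1} - N" for v
    unfolding AE_lborel_iff_negligible[symmetric]
  proof -
    have v': "v \<in> {0<..<1}" and ae: "AE u in lborel. extend C u differentiable (at v)"
      using good[OF v] by auto
    \<comment> \<open>Besides the \<open>u\<close> without an inner derivative, the excluded points
      are the edges \<open>0\<close> and \<open>1\<close> and the crossings \<open>v\<close> and
      \<open>1 - v\<close> with the diagonals, where \<open>M - W\<close> has its kinks.\<close>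
    show "AE u in lborel. u \<in> {0..1} \<longrightarrow> mixed_partial C u v = ?K u v \<and> mixed_partial (C_alpha C \<alpha>) u v = ?K u v"
      using ae AE_lborel_singleton[of 0] AE_lborel_singleton[of 1] AE_lborel_singleton[of v] AE_lborel_singleton[of "1 - v"]
    proof eventually_elim
      case (elim u)
      show ?case
      proof
        assume "u \<in> {0..1}"
        with elim have u: "u \<in> {0<..<1}" by auto
        have "mixed_partial C u v = ?K u v"
          using mixed_partial_eq_mixed_deriv[OF C v' u ae elim(1)] .
        moreover have "mixed_partial (C_alpha C \<alpha>) u v = mixed_partial C u v"
          using elim u v' by (intro mixed_partial_C_alpha) (auto simp: partial_v_dom_eq)
        ultimately show "mixed_partial C u v = ?K u v \<and> mixed_partial (C_alpha C \<alpha>) u v = ?K u v" by simp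
      qed
    qed
  qed
  have inner: "integral {0..1} (\<lambda>u. C u v * mixed_partial C u v) = ?P v"
      "integral {0..1} (\<lambda>u. ?L u v * mixed_partial C u v) = ?R v"
      "integral {0..1} (\<lambda>u. C_alpha C \<alpha> u v * mixed_partial (C_alpha C \<alpha>) u v) = ?P v + \<alpha> / 2 * ?R v"
    if v: "v \<in> {0..1} - N" for v
  proof -
    show "integral {0..1} (\<lambda>u. C u v * mixed_partial C u v) = ?P v"
      "integral {0..1} (\<lambda>u. ?L u v * mixed_partial C u v) = ?R v"
      by (rule integral_spike[OF mp[OF v]]; use v in auto)+
    have "integral {0..1} (\<lambda>u. C_alpha C \<alpha> u v * mixed_partial (C_alpha C \<alpha>) u v) =
      integral {0..1} (\<lambda>u. extend C u v * ?K u v + \<alpha> / 2 * (?L u v * ?K u v))"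
      by (rule integral_spike[OF mp[OF v]]; use v in \<open>auto simp: C_alpha_def algebra_simps\<close>)
    also have "\<dots> = ?P v + \<alpha> / 2 * ?R v"
      using good[OF v] by (intro integral_unique has_integral_add has_integral_mult_right integrable_integral) auto
    finally show "integral {0..1} (\<lambda>u. C_alpha C \<alpha> u v * mixed_partial (C_alpha C \<alpha>) u v) = ?P v + \<alpha> / 2 * ?R v" .
  qed
  have "integral {0..1} (\<lambda>v. integral {0..1} (\<lambda>u. C_alpha C \<alpha> u v * mixed_partial (C_alpha C \<alpha>) u v))
      = integral {0..1} (\<lambda>v. ?P v + \<alpha> / 2 * ?R v)"
    by (rule integral_spike[OF N]) (simp add: inner)
  also have "\<dots> = integral {0..1} ?P + \<alpha> / 2 * integral {0..1} ?R"
    by (intro integral_unique has_integral_add has_integral_mult_right integrable_integral outer)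
  also have "integral {0..1} ?P = integral {0..1} (\<lambda>v. integral {0..1} (\<lambda>u. C u v * mixed_partial C u v))"
    by (rule integral_spike[OF N]) (simp add: inner)
  also have "integral {0..1} ?R = integral {0..1} (\<lambda>v. integral {0..1} (\<lambda>u. ?L u v * mixed_partial C u v))"
    by (rule integral_spike[OF N]) (simp add: inner)
  finally show ?thesis by (simp add: kendall_tau_def)
qed

theorem theorem2p5:
  fixes C :: "real \<Rightarrow> real \<Rightarrow> real" and \<alpha> :: real
  assumes "is_copula C" and "\<alpha> \<in> {0..1}"
  shows "spearman_rho (C_alpha C \<alpha>) = spearman_rho C + \<alpha> \<and>
         blomqvist_beta (C_alpha C \<alpha>) = blomqvist_beta C + \<alpha> \<and>
         gini_gamma (C_alpha C \<alpha>) = gini_gamma C + \<alpha> \<and>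
         kendall_tau (C_alpha C \<alpha>) = kendall_tau C +
           2 * \<alpha> * integral {0..1} (\<lambda>v. integral {0..1}
             (\<lambda>u. (M_cop u v - W_cop u v) * mixed_partial C u v))"
  using spearman_rho_C_alpha[OF assms(1)] blomqvist_beta_C_alpha gini_gamma_C_alpha[OF assms(1)]
    kendall_tau_C_alpha[OF assms(1)]
  by blast

end
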